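(* For every set of real numbers $\{i_T\in\mathbb{R}:T\subseteq N,\ |T|\text{ odd}\}$, the unique function $f_{\mathcal{S}}\in\mathcal{S}$ such that $\Phi_{\mathrm{B}}(f_{\mathcal{S}},T)=i_T$ for every $T\subseteq N$ with $|T|$ odd is given by $$f_{\mathcal{S}}=\frac12\sum_{\substack{S\subseteq N\\ |S|\text{ odd}}}\Bigg(\sum_{\substack{T\subseteq S\\ |T|\text{ odd}}}E_{|S|-|T|}\,i_T\Bigg)v_S.$$
   Context: Let $n\geqslant 1$ and $N=\{1,\ldots,n\}$. Boolean vectors $\mathbf{x}\in\{0,1\}^n$ are identified with subsets $T\subseteq N$ via $x_i=1\iff i\in T$. $\mathcal{F}^N$ is the real vector space of all functions $f\colon\{0,1\}^n\to\mathbb{R}$ (equivalently $f\colon 2^N\to\mathbb{R}$). For $f\in\mathcal{F}^N$ define $f^*\in\mathcal{F}^N$ by $f^*(S)=-f(N\setminus S)$, and set $\mathcal{S}=\{f\in\mathcal{F}^N:f^*=f\}$. For $S\subseteq N$ let $v_S(\mathbf{x})=\prod_{i\in S}(2x_i-1)$. The Banzhaf influence index is $\Phi_{\mathrm{B}}(f,S)=\frac{1}{2^{n-|S|}}\sum_{T\subseteq N\setminus S}(f(T\cup S)-f(T))$. $E_m(x)$ denotes the $m$th Euler polynomial, defined by $\frac{2e^{xt}}{e^t+1}=\sum_{m\geqslant0}E_m(x)\frac{t^m}{m!}$, and $E_m=2^mE_m(\tfrac12)$ is the $m$th Euler number (so $E_0=1$, $E_2=-1$, $E_4=5$). *)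

theory Defs
  imports "HOL-Library.FuncSet" "HOL-Computational_Algebra.Formal_Power_Series"
begin

definition ground :: "nat \<Rightarrow> nat set" where
  "ground n = {1..n}"

text \<open>
  Boolean vectors of length \<open>n\<close> are represented by subsets of \<open>ground n\<close>.
  Functions are extensional (undefined outside \<open>Pow (ground n)\<close>), so that HOL equality on
  \<open>\<F>\<close> is equality of functions on the power set.
\<close>

definition \<F> :: "nat \<Rightarrow> (nat set \<Rightarrow> real) set" where
  "\<F> n = Pow (ground n) \<rightarrow>\<^sub>E UNIV"

definition dual :: "nat \<Rightarrow> (nat set \<Rightarrow> real) \<Rightarrow> (nat set \<Rightarrow> real)" where
  "dual n f = (\<lambda>S\<in>Pow (ground n). - f (ground n - S))"

definition self_dual :: "nat \<Rightarrow> (nat set \<Rightarrow> real) set" where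
  "self_dual n = {f \<in> \<F> n. dual n f = f}"

text \<open>The factor \<open>of_bool (i \<in> T)\<close> is the coordinate \<open>x\<^sub>i\<close> of the Boolean vector given by \<open>T\<close>.\<close>

definition v :: "nat \<Rightarrow> nat set \<Rightarrow> (nat set \<Rightarrow> real)" where
  "v n S = (\<lambda>T\<in>Pow (ground n). \<Prod>i\<in>S. 2 * of_bool (i \<in> T) - 1)"

definition banzhaf_influence :: "nat \<Rightarrow> (nat set \<Rightarrow> real) \<Rightarrow> nat set \<Rightarrow> real" where
  "banzhaf_influence n f S =
     1 / 2 ^ (n - card S) * (\<Sum>T\<in>Pow (ground n - S). f (T \<union> S) - f T)"

text \<open>
  The value \<open>E\<^sub>m(x)\<close> of the Euler polynomial, read off its exponential generating function
  \<open>2 e\<^sup>x\<^sup>t / (e\<^sup>t + 1)\<close>, a power series in \<open>t\<close> for each fixed \<open>x\<close>.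
\<close>

definition euler_poly :: "nat \<Rightarrow> real \<Rightarrow> real" where
  "euler_poly m x = fact m * fps_nth (2 * fps_exp x / (fps_exp 1 + 1)) m"

definition euler_number :: "nat \<Rightarrow> real" where
  "euler_number m = 2 ^ m * euler_poly m (1 / 2)"

end

theory Submission
  imports Defs
begin

text \<open>
  The functions \<open>v\<^sub>S\<close> are the Fourier characters of the cube, and \<open>f\<close> is self-dual iff only
  characters with \<open>|S|\<close> odd occur in its expansion \<open>f = \<Sum>\<^sub>S c\<^sub>S v\<^sub>S\<close>. For odd \<open>|S|\<close> the
  influence \<open>\<Phi>\<^sub>B(v\<^sub>S, T)\<close> is \<open>2\<close> if \<open>S \<subseteq> T\<close> and \<open>0\<close> otherwise, so the prescribed influences say
  \<open>i\<^sub>T = 2 \<Sum>\<^sub>S c\<^sub>S\<close> with \<open>S\<close> ranging over the odd subsets of \<open>T\<close>. This system is inverted by the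
  Euler numbers because \<open>sech \<cdot> cosh = 1\<close>.
\<close>

section \<open>Euler numbers and their alternating sums over intervals of sets\<close>

text \<open>The first factor is sech(t/2), written as the Euler generating function at
  \<open>x = 1/2\<close>; multiplying its numerator by 2 cosh(t/2) reproduces twice its
  denominator.\<close>

lemma euler_number_gf_mult_cosh:
  "(2 * fps_exp (1/2) / (fps_exp 1 + 1)) * (fps_exp (1/2) + fps_exp (-1/2)) = (2 :: real fps)"
proof -
  define D :: "real fps" where "D = fps_exp 1 + 1"
  have "fps_nth D 0 \<noteq> 0" by (simp add: D_def)
  then have D: "inverse D * D = 1" by (rule inverse_mult_eq_1)
  have D': "fps_exp (1/2) * (fps_exp (1/2) + fps_exp (-1/2)) = D"
    by (simp add: D_def distrib_left flip: fps_exp_add_mult)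
  have "2 * fps_exp (1/2) / D = 2 * fps_exp (1/2) * inverse D"
    using \<open>fps_nth D 0 \<noteq> 0\<close> by (simp add: fps_divide_unit)
  then have "2 * fps_exp (1/2) / D * (fps_exp (1/2) + fps_exp (-1/2)) = 2 * (inverse D * D)"
    unfolding D'[symmetric] by (simp only: mult_ac)
  then show ?thesis unfolding D by (simp add: D_def)
qed

text \<open>This compares coefficients of t^m in the preceding identity. For even \<open>m\<close>
  the terms with odd \<open>k\<close> drop out, because the two exponentials cancel in odd degree
  \<open>m - k\<close>.\<close>

lemma sum_binomial_euler_number:
  assumes "even m"
  shows "(\<Sum>k | k \<le> m \<and> even k. (m choose k) * euler_number k) = of_bool (m = 0)"
proof -
  define G :: "real fps" where "G = 2 * fps_exp (1/2) / (fps_exp 1 + 1)"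
  have E: "euler_number k = 2 ^ k * fact k * fps_nth G k" for k
    by (simp add: euler_number_def euler_poly_def G_def)
  \<comment> \<open>The \<open>k\<close>-th term of the Cauchy product that gives the coefficient of
    t^m.\<close>
  define h where "h k = fps_nth G k * (((1/2) ^ (m - k) + (-1/2) ^ (m - k)) / fact (m - k))" for k
  have "(\<Sum>k\<le>m. h k) = fps_nth (G * (fps_exp (1/2) + fps_exp (-1/2))) m"
    by (simp add: fps_mult_nth h_def atLeast0AtMost add_divide_distrib)
  also have "\<dots> = 2 * of_bool (m = 0)"
    unfolding G_def euler_number_gf_mult_cosh by (simp add: numeral_fps_const)
  finally have "(\<Sum>k\<le>m. h k) = 2 * of_bool (m = 0)" .
  moreover have "(\<Sum>k | k \<le> m \<and> even k. h k) = (\<Sum>k\<le>m. h k)"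
    using assms by (intro sum.mono_neutral_left) (auto simp: h_def)
  \<comment> \<open>For even \<open>m - k\<close> the bracket in \<open>h k\<close> is 2 / 2^(m-k),
    so the factor 2^m / 2 leaves exactly the 2^k of the Euler number.\<close>
  moreover have "(m choose k) * euler_number k = fact m * 2 ^ m / 2 * h k"
    if "k \<le> m" "even k" for k
    using that assms
    by (simp add: E h_def binomial_fact power_diff power_divide field_simps)
  then have "(\<Sum>k | k \<le> m \<and> even k. (m choose k) * euler_number k)
      = fact m * 2 ^ m / 2 * (\<Sum>k | k \<le> m \<and> even k. h k)"
    unfolding sum_distrib_left by (intro sum.cong) auto
  ultimately show ?thesis by (cases "m = 0") auto
qed

text \<open>Grouping the subsets by cardinality produces the binomial coefficients of the preceding
  sum.\<close>

lemma sum_even_subsets_euler_number: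
  assumes "finite D" "even (card D)"
  shows "(\<Sum>W | W \<subseteq> D \<and> even (card W). euler_number (card W)) = of_bool (D = {})"
proof -
  have "(\<Sum>W | W \<subseteq> D \<and> even (card W). euler_number (card W))
      = (\<Sum>k | k \<le> card D \<and> even k. \<Sum>W | W \<in> {W. W \<subseteq> D \<and> even (card W)} \<and> card W = k.
          euler_number (card W))"
    using assms by (intro sum.group[symmetric]) (auto intro: card_mono)
  also have "\<dots> = (\<Sum>k | k \<le> card D \<and> even k. (card D choose k) * euler_number k)"
  proof (intro sum.cong refl)
    fix k assume k: "k \<in> {k. k \<le> card D \<and> even k}"
    then have "{W \<in> {W. W \<subseteq> D \<and> even (card W)}. card W = k} = {W. W \<subseteq> D \<and> card W = k}"
      by auto
    then show "(\<Sum>W | W \<in> {W. W \<subseteq> D \<and> even (card W)} \<and> card W = k. euler_number (card W))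
        = (card D choose k) * euler_number k"
      using assms by (simp add: n_subsets)
  qed
  also have "\<dots> = of_bool (D = {})"
    using assms by (simp add: sum_binomial_euler_number)
  finally show ?thesis .
qed

text \<open>Both sums reduce to even subsets \<open>W\<close> of \<open>S - U\<close>, a set of even
  size: the first through \<open>W = T - U\<close>, the second through \<open>W = S - T\<close>.
  They serve the two directions of the inversion.\<close>

lemma sum_odd_between_euler_number:
  assumes "finite S" "U \<subseteq> S" "odd (card U)" "odd (card S)"
  shows "(\<Sum>T | U \<subseteq> T \<and> T \<subseteq> S \<and> odd (card T). euler_number (card T - card U)) = of_bool (U = S)"
    and "(\<Sum>T | U \<subseteq> T \<and> T \<subseteq> S \<and> odd (card T). euler_number (card S - card T)) = of_bool (U = S)"
proof -
  have fin: "finite T" if "T \<subseteq> S" for T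
    using that assms finite_subset by blast
  have ev: "even (card (S - U))"
    using assms by (simp add: card_Diff_subset fin card_mono)
  have rhs: "(\<Sum>W | W \<subseteq> S - U \<and> even (card W). euler_number (card W)) = of_bool (U = S)"
    using sum_even_subsets_euler_number[OF _ ev] assms by auto
  have card_T: "card (T - U) = card T - card U" "card (S - T) = card S - card T"
      "card U \<le> card T" "card T \<le> card S"
    if "U \<subseteq> T" "T \<subseteq> S" for T
    using that assms fin[of U] fin[of T] by (auto intro: card_Diff_subset card_mono)
  have odd_iff: "odd (card T) \<longleftrightarrow> even (card (T - U))" "odd (card T) \<longleftrightarrow> even (card (S - T))"
    if "U \<subseteq> T" "T \<subseteq> S" for T
    using card_T[OF that] assms by simp_all
  have "(\<Sum>T | U \<subseteq> T \<and> T \<subseteq> S \<and> odd (card T). euler_number (card (T - U)))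
      = (\<Sum>W | W \<subseteq> S - U \<and> even (card W). euler_number (card W))"
  proof (rule sum.reindex_bij_witness[where i = "\<lambda>W. U \<union> W" and j = "\<lambda>T. T - U"])
    fix W assume W: "W \<in> {W. W \<subseteq> S - U \<and> even (card W)}"
    then show "U \<union> W - U = W" by blast
    then show "U \<union> W \<in> {T. U \<subseteq> T \<and> T \<subseteq> S \<and> odd (card T)}"
      using W assms(2) odd_iff(1)[of "U \<union> W"] by auto
  qed (use odd_iff(1) in auto)
  then show "(\<Sum>T | U \<subseteq> T \<and> T \<subseteq> S \<and> odd (card T). euler_number (card T - card U)) = of_bool (U = S)"
    unfolding rhs by (simp add: card_T(1) cong: conj_cong)
  have "(\<Sum>T | U \<subseteq> T \<and> T \<subseteq> S \<and> odd (card T). euler_number (card (S - T)))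
      = (\<Sum>W | W \<subseteq> S - U \<and> even (card W). euler_number (card W))"
  proof (rule sum.reindex_bij_witness[where i = "\<lambda>W. S - W" and j = "\<lambda>T. S - T"])
    fix W assume W: "W \<in> {W. W \<subseteq> S - U \<and> even (card W)}"
    then show "S - (S - W) = W" by blast
    then show "S - W \<in> {T. U \<subseteq> T \<and> T \<subseteq> S \<and> odd (card T)}"
      using W assms(2) odd_iff(2)[of "S - W"] by auto
  qed (use odd_iff(2) in auto)
  then show "(\<Sum>T | U \<subseteq> T \<and> T \<subseteq> S \<and> odd (card T). euler_number (card S - card T)) = of_bool (U = S)"
    unfolding rhs by (simp add: card_T(2) cong: conj_cong)
qed

section \<open>Inversion of sums over odd subsets\<close>

lemma sum_nested_subsets_swap:
  fixes h :: "'a set \<Rightarrow> 'a set \<Rightarrow> real"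
  assumes "finite S"
  shows "(\<Sum>T | T \<subseteq> S \<and> P T. \<Sum>U | U \<subseteq> T \<and> P U. h T U)
       = (\<Sum>U | U \<subseteq> S \<and> P U. \<Sum>T | U \<subseteq> T \<and> T \<subseteq> S \<and> P T. h T U)"
proof -
  have "(\<Sum>T | T \<subseteq> S \<and> P T. \<Sum>U | U \<subseteq> T \<and> P U. h T U)
      = (\<Sum>T | T \<subseteq> S \<and> P T. \<Sum>U | U \<in> {U. U \<subseteq> S \<and> P U} \<and> U \<subseteq> T. h T U)"
    by (intro sum.cong refl) auto
  also have "\<dots> = (\<Sum>U | U \<subseteq> S \<and> P U. \<Sum>T | T \<in> {T. T \<subseteq> S \<and> P T} \<and> U \<subseteq> T. h T U)"
    using assms by (intro sum.swap_restrict) auto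
  also have "\<dots> = (\<Sum>U | U \<subseteq> S \<and> P U. \<Sum>T | U \<subseteq> T \<and> T \<subseteq> S \<and> P T. h T U)"
    by (intro sum.cong refl) auto
  finally show ?thesis .
qed

lemma sum_odd_subsets_kronecker:
  fixes g :: "'a set \<Rightarrow> real"
  assumes "finite S" "odd (card S)"
  shows "(\<Sum>U | U \<subseteq> S \<and> odd (card U). of_bool (U = S) * g U) = g S"
proof -
  have "(\<Sum>U | U \<subseteq> S \<and> odd (card U). of_bool (U = S) * g U)
      = (\<Sum>U | U \<subseteq> S \<and> odd (card U). if U = S then g U else 0)"
    by (intro sum.cong) auto
  also have "\<dots> = g S"
    using assms by (simp add: sum.delta)
  finally show ?thesis .
qed

text \<open>Coefficients are recovered from their subset sums, which will give uniqueness. After the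
  swap, the inner Euler sum over the interval from \<open>U\<close> to \<open>S\<close> is a
  Kronecker delta.\<close>

lemma euler_inversion_left:
  assumes "finite S" "odd (card S)"
  shows "(\<Sum>T | T \<subseteq> S \<and> odd (card T). euler_number (card S - card T) *
            (\<Sum>U | U \<subseteq> T \<and> odd (card U). c U)) = c S"
proof -
  have "(\<Sum>T | T \<subseteq> S \<and> odd (card T). euler_number (card S - card T) *
            (\<Sum>U | U \<subseteq> T \<and> odd (card U). c U))
      = (\<Sum>U | U \<subseteq> S \<and> odd (card U).
          (\<Sum>T | U \<subseteq> T \<and> T \<subseteq> S \<and> odd (card T). euler_number (card S - card T)) * c U)"
    unfolding sum_distrib_left sum_distrib_right
    by (rule sum_nested_subsets_swap) fact
  also have "\<dots> = (\<Sum>U | U \<subseteq> S \<and> odd (card U). of_bool (U = S) * c U)"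
    using assms by (intro sum.cong refl) (simp add: sum_odd_between_euler_number(2))
  also have "\<dots> = c S"
    using assms by (rule sum_odd_subsets_kronecker)
  finally show ?thesis .
qed

text \<open>The Euler-weighted coefficients have the prescribed subset sums, which will give
  existence.\<close>

lemma euler_inversion_right:
  assumes "finite S" "odd (card S)"
  shows "(\<Sum>T | T \<subseteq> S \<and> odd (card T).
            \<Sum>U | U \<subseteq> T \<and> odd (card U). euler_number (card T - card U) * g U) = g S"
proof -
  have "(\<Sum>T | T \<subseteq> S \<and> odd (card T).
            \<Sum>U | U \<subseteq> T \<and> odd (card U). euler_number (card T - card U) * g U)
      = (\<Sum>U | U \<subseteq> S \<and> odd (card U).
          (\<Sum>T | U \<subseteq> T \<and> T \<subseteq> S \<and> odd (card T). euler_number (card T - card U)) * g U)"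
    unfolding sum_distrib_right by (rule sum_nested_subsets_swap) fact
  also have "\<dots> = (\<Sum>U | U \<subseteq> S \<and> odd (card U). of_bool (U = S) * g U)"
    using assms by (intro sum.cong refl) (simp add: sum_odd_between_euler_number(1))
  also have "\<dots> = g S"
    using assms by (rule sum_odd_subsets_kronecker)
  finally show ?thesis .
qed

section \<open>Characters of the cube and their orthogonality\<close>

lemma finite_ground [simp]: "finite (ground n)"
  and card_ground [simp]: "card (ground n) = n"
  by (simp_all add: ground_def)

lemma finite_subset_ground: "S \<subseteq> ground n \<Longrightarrow> finite S"
  using finite_subset by fastforce

lemma v_apply: "X \<subseteq> ground n \<Longrightarrow> v n S X = (\<Prod>i\<in>S. 2 * of_bool (i \<in> X) - 1)"
  by (simp add: v_def)

text \<open>Complementation negates each of the \<open>card S\<close> factors.\<close>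

lemma v_compl:
  assumes "S \<subseteq> ground n" "X \<subseteq> ground n"
  shows "v n S (ground n - X) = (-1) ^ card S * v n S X"
proof -
  have "v n S (ground n - X) = (\<Prod>i\<in>S. - (2 * of_bool (i \<in> X) - 1))"
    unfolding v_apply[OF Diff_subset] using assms by (intro prod.cong) auto
  also have "\<dots> = (\<Prod>i\<in>S. (-1) * (2 * of_bool (i \<in> X) - 1))"
    by simp
  also have "\<dots> = (-1) ^ card S * v n S X"
    unfolding prod.distrib using assms by (simp add: v_apply)
  finally show ?thesis .
qed

text \<open>The subsets of \<open>A\<close> pair off as \<open>U\<close> and
  \<open>insert j U\<close>, and each pair contributes zero.\<close>

lemma sum_Pow_cancel:
  fixes h :: "'a set \<Rightarrow> real"
  assumes "finite A" "j \<in> A" "\<And>U. U \<subseteq> A - {j} \<Longrightarrow> h (insert j U) = - h U"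
  shows "(\<Sum>U\<in>Pow A. h U) = 0"
proof -
  have A: "A = insert j (A - {j})" using assms by auto
  have "Pow A = Pow (A - {j}) \<union> insert j ` Pow (A - {j})"
    using A Pow_insert by metis
  then have "(\<Sum>U\<in>Pow A. h U) = (\<Sum>U\<in>Pow (A - {j}). h U) + (\<Sum>U\<in>insert j ` Pow (A - {j}). h U)"
    using assms(1) by (simp only:) (subst sum.union_disjoint, auto)
  also have "(\<Sum>U\<in>insert j ` Pow (A - {j}). h U) = (\<Sum>U\<in>Pow (A - {j}). h (insert j U))"
    by (subst sum.reindex) (auto simp: inj_on_def)
  also have "\<dots> = - (\<Sum>U\<in>Pow (A - {j}). h U)"
    using assms(3) by (simp add: sum_negf)
  finally show ?thesis by simp
qed

text \<open>Orthogonality with the points fixed and the index \<open>S\<close> varying, the form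
  that inversion needs. If some \<open>j\<close> separates \<open>X\<close> from \<open>Y\<close>,
  toggling \<open>j\<close> in \<open>S\<close> flips the sign of the product.\<close>

lemma sum_v_mult_v:
  assumes "X \<subseteq> ground n" "Y \<subseteq> ground n"
  shows "(\<Sum>S\<in>Pow (ground n). v n S X * v n S Y) = 2 ^ n * of_bool (X = Y)"
proof (cases "X = Y")
  case True
  have "v n S X * v n S X = 1" for S
    using assms by (simp add: v_apply flip: prod.distrib) (rule prod.neutral, simp)
  then show ?thesis using True by (simp add: card_Pow)
next
  case False
  then obtain j where j: "j \<in> ground n" "(j \<in> X) \<noteq> (j \<in> Y)"
    using assms by blast
  have "(\<Sum>S\<in>Pow (ground n). v n S X * v n S Y) = 0"
  proof (rule sum_Pow_cancel[OF _ j(1)])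
    fix S assume S: "S \<subseteq> ground n - {j}"
    then have "finite S" "j \<notin> S" by (auto intro: finite_subset)
    then show "v n (insert j S) X * v n (insert j S) Y = - (v n S X * v n S Y)"
      using assms j(2) by (auto simp: v_apply)
  qed simp
  then show ?thesis using False by simp
qed

section \<open>Fourier expansion of self-dual functions\<close>

definition fourier_coeff :: "nat \<Rightarrow> (nat set \<Rightarrow> real) \<Rightarrow> nat set \<Rightarrow> real" where
  "fourier_coeff n f S = (\<Sum>Y\<in>Pow (ground n). f Y * v n S Y) / 2 ^ n"

lemma fourier_inversion:
  assumes "X \<subseteq> ground n"
  shows "(\<Sum>S\<in>Pow (ground n). fourier_coeff n f S * v n S X) = f X"
proof -
  have "(\<Sum>S\<in>Pow (ground n). fourier_coeff n f S * v n S X)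
      = (\<Sum>S\<in>Pow (ground n). \<Sum>Y\<in>Pow (ground n). f Y / 2 ^ n * (v n S Y * v n S X))"
    unfolding fourier_coeff_def sum_divide_distrib sum_distrib_right
    by (intro sum.cong refl) simp
  also have "\<dots> = (\<Sum>Y\<in>Pow (ground n). f Y / 2 ^ n * (\<Sum>S\<in>Pow (ground n). v n S Y * v n S X))"
    unfolding sum_distrib_left by (rule sum.swap)
  also have "\<dots> = (\<Sum>Y\<in>Pow (ground n). if Y = X then f Y else 0)"
    using assms by (intro sum.cong refl) (simp add: sum_v_mult_v)
  also have "\<dots> = f X"
    using assms by simp
  finally show ?thesis .
qed

lemma self_dual_compl:
  assumes "f \<in> self_dual n" "X \<subseteq> ground n"
  shows "f (ground n - X) = - f X"
proof -
  have "dual n f X = f X" using assms by (simp add: self_dual_def)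
  then show ?thesis using assms by (simp add: dual_def)
qed

text \<open>Under the substitution of \<open>ground n - Y\<close> for \<open>Y\<close>,
  \<open>f\<close> changes sign and the even character does not, so the sum equals its own
  negative.\<close>

lemma fourier_coeff_even_zero:
  assumes "f \<in> self_dual n" "S \<subseteq> ground n" "even (card S)"
  shows "fourier_coeff n f S = 0"
proof -
  have "(\<Sum>Y\<in>Pow (ground n). f Y * v n S Y)
      = (\<Sum>Y\<in>Pow (ground n). f (ground n - Y) * v n S (ground n - Y))"
    by (rule sum.reindex_bij_witness[where i = "\<lambda>Y. ground n - Y" and j = "\<lambda>Y. ground n - Y"])
       (auto simp: double_diff)
  also have "\<dots> = - (\<Sum>Y\<in>Pow (ground n). f Y * v n S Y)"
    using assms by (simp add: self_dual_compl v_compl sum_negf)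
  finally show ?thesis by (simp add: fourier_coeff_def)
qed

text \<open>The restriction puts the result in \<open>\<F> n\<close>, so that it can be equated with
  self-dual functions.\<close>

definition odd_expansion :: "nat \<Rightarrow> (nat set \<Rightarrow> real) \<Rightarrow> (nat set \<Rightarrow> real)" where
  "odd_expansion n c =
     (\<lambda>X\<in>Pow (ground n). \<Sum>S | S \<subseteq> ground n \<and> odd (card S). c S * v n S X)"

lemma self_dual_eq_odd_expansion:
  assumes "f \<in> self_dual n"
  shows "f = odd_expansion n (fourier_coeff n f)"
proof
  fix X
  show "f X = odd_expansion n (fourier_coeff n f) X"
  proof (cases "X \<subseteq> ground n")
    case True
    then have "f X = (\<Sum>S\<in>Pow (ground n). fourier_coeff n f S * v n S X)"
      by (simp add: fourier_inversion)
    also have "\<dots> = (\<Sum>S | S \<subseteq> ground n \<and> odd (card S). fourier_coeff n f S * v n S X)"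
      using assms by (intro sum.mono_neutral_right) (auto simp: fourier_coeff_even_zero)
    finally show ?thesis using True by (simp add: odd_expansion_def)
  next
    \<comment> \<open>Off the power set both sides are \<open>undefined\<close> by
      extensionality.\<close>
    case False
    moreover have "f \<in> Pow (ground n) \<rightarrow>\<^sub>E UNIV"
      using assms by (simp add: self_dual_def \<F>_def)
    ultimately show ?thesis
      using PiE_arb[of f _ _ X] by (simp add: odd_expansion_def)
  qed
qed

lemma odd_expansion_self_dual: "odd_expansion n c \<in> self_dual n"
proof -
  have "- odd_expansion n c (ground n - X) = odd_expansion n c X" if "X \<subseteq> ground n" for X
    using that by (simp add: odd_expansion_def v_compl sum_negf)
  then have "dual n (odd_expansion n c) = odd_expansion n c"
    by (simp add: dual_def fun_eq_iff restrict_def) (simp add: odd_expansion_def)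
  then show ?thesis
    by (simp add: self_dual_def \<F>_def odd_expansion_def)
qed

section \<open>Banzhaf influences of odd expansions\<close>

text \<open>If \<open>S \<subseteq> T\<close>, the character is 1 at \<open>U \<union> T\<close> and
  (-1)^|S| = -1 at \<open>U\<close>, which misses \<open>S\<close>. Otherwise toggling some
  \<open>j\<close> in \<open>S - T\<close> negates both terms and everything cancels.\<close>

lemma sum_v_Diff:
  assumes "S \<subseteq> ground n" "T \<subseteq> ground n" "odd (card S)"
  shows "(\<Sum>U\<in>Pow (ground n - T). v n S (U \<union> T) - v n S U)
      = 2 * 2 ^ (n - card T) * of_bool (S \<subseteq> T)"
proof (cases "S \<subseteq> T")
  case True
  have "v n S (U \<union> T) - v n S U = 2" if "U \<subseteq> ground n - T" for U
  proof -
    have "v n S (U \<union> T) = (\<Prod>i\<in>S. 1)"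
      using that True assms by (subst v_apply) (auto intro!: prod.neutral)
    moreover have "v n S U = (\<Prod>i\<in>S. -1)"
      using that True assms by (subst v_apply) (auto intro!: prod.cong simp del: prod_constant)
    ultimately show ?thesis using assms by simp
  qed
  then show ?thesis
    using True assms finite_subset_ground[OF assms(2)]
    by (simp add: card_Pow card_Diff_subset)
next
  case False
  then obtain j where j: "j \<in> S" "j \<notin> T" by blast
  have fin: "finite S" using assms finite_subset_ground by blast
  have flip: "v n S (insert j W) = - v n S W" if "W \<subseteq> ground n" "j \<notin> W" for W
  proof -
    have "(\<Prod>i\<in>S - {j}. 2 * of_bool (i \<in> insert j W) - 1)
        = (\<Prod>i\<in>S - {j}. 2 * of_bool (i \<in> W) - (1::real))"
      by (intro prod.cong) auto
    moreover have "insert j W \<subseteq> ground n" using that j assms by auto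
    ultimately show ?thesis
      using that fin j by (simp add: v_apply prod.remove[of S j])
  qed
  have "(\<Sum>U\<in>Pow (ground n - T). v n S (U \<union> T) - v n S U) = 0"
  proof (rule sum_Pow_cancel[of _ j])
    fix U assume U: "U \<subseteq> ground n - T - {j}"
    then have "v n S (insert j (U \<union> T)) = - v n S (U \<union> T)"
      using assms j by (intro flip) auto
    moreover have "v n S (insert j U) = - v n S U"
      using U by (intro flip) auto
    ultimately show "v n S (insert j U \<union> T) - v n S (insert j U) = - (v n S (U \<union> T) - v n S U)"
      by simp
  qed (use assms j in auto)
  then show ?thesis using False by simp
qed

text \<open>By linearity only characters with \<open>S \<subseteq> T\<close> survive, and the number
  2^(n - |T|) of sets \<open>U\<close> cancels the normalisation of the index.\<close>

lemma banzhaf_influence_odd_expansion: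
  assumes "T \<subseteq> ground n"
  shows "banzhaf_influence n (odd_expansion n c) T = 2 * (\<Sum>S | S \<subseteq> T \<and> odd (card S). c S)"
proof -
  define Odd where "Odd = {S. S \<subseteq> ground n \<and> odd (card S)}"
  have "finite Odd" by (simp add: Odd_def)
  have "(\<Sum>U\<in>Pow (ground n - T). odd_expansion n c (U \<union> T) - odd_expansion n c U)
      = (\<Sum>U\<in>Pow (ground n - T). \<Sum>S\<in>Odd. c S * (v n S (U \<union> T) - v n S U))"
  proof (intro sum.cong refl)
    fix U assume "U \<in> Pow (ground n - T)"
    then have "U \<subseteq> ground n" "U \<union> T \<subseteq> ground n" using assms by auto
    then show "odd_expansion n c (U \<union> T) - odd_expansion n c U
        = (\<Sum>S\<in>Odd. c S * (v n S (U \<union> T) - v n S U))"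
      by (simp add: odd_expansion_def Odd_def right_diff_distrib sum_subtractf)
  qed
  also have "\<dots> = (\<Sum>S\<in>Odd. c S * (\<Sum>U\<in>Pow (ground n - T). v n S (U \<union> T) - v n S U))"
    unfolding sum_distrib_left by (rule sum.swap)
  also have "\<dots> = (\<Sum>S\<in>Odd. if S \<subseteq> T then 2 * 2 ^ (n - card T) * c S else 0)"
    using assms by (intro sum.cong refl) (simp add: Odd_def sum_v_Diff)
  also have "\<dots> = (\<Sum>S\<in>{S \<in> Odd. S \<subseteq> T}. 2 * 2 ^ (n - card T) * c S)"
    using \<open>finite Odd\<close> by (simp add: sum.inter_filter)
  also have "{S \<in> Odd. S \<subseteq> T} = {S. S \<subseteq> T \<and> odd (card S)}"
    using assms by (auto simp: Odd_def)
  finally show ?thesis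
    by (simp add: banzhaf_influence_def flip: sum_distrib_left)
qed

theorem proposition4p8:
  fixes n :: nat and i :: "nat set \<Rightarrow> real"
  assumes "n \<ge> 1"
  shows
    "(\<exists>!f. f \<in> self_dual n \<and>
        (\<forall>T. T \<subseteq> ground n \<and> odd (card T) \<longrightarrow> banzhaf_influence n f T = i T)) \<and>
     (\<forall>f. f \<in> self_dual n \<and>
        (\<forall>T. T \<subseteq> ground n \<and> odd (card T) \<longrightarrow> banzhaf_influence n f T = i T) \<longrightarrow>
        f = (\<lambda>X\<in>Pow (ground n). 1 / 2 *
              (\<Sum>S | S \<subseteq> ground n \<and> odd (card S).
                (\<Sum>T | T \<subseteq> S \<and> odd (card T). euler_number (card S - card T) * i T) * v n S X)))"
    (is "(\<exists>!f. ?P f) \<and> (\<forall>f. ?P f \<longrightarrow> f = ?g)")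
proof -
  \<comment> \<open>The halved \<open>i T\<close> absorbs the factor 2 in
    \<open>banzhaf_influence_odd_expansion\<close>.\<close>
  define c where
    "c S = (\<Sum>T | T \<subseteq> S \<and> odd (card T). euler_number (card S - card T) * (i T / 2))" for S
  have g: "?g = odd_expansion n c"
    by (simp add: odd_expansion_def c_def sum_distrib_left sum_divide_distrib sum_distrib_right
        mult_ac cong: restrict_cong)
  have "banzhaf_influence n ?g T = i T" if "T \<subseteq> ground n" "odd (card T)" for T
    unfolding g banzhaf_influence_odd_expansion[OF that(1)] c_def
    using that euler_inversion_right[of T "\<lambda>U. i U / 2"] by (simp add: finite_subset_ground)
  then have P: "?P ?g"
    unfolding g by (simp add: odd_expansion_self_dual)
  \<comment> \<open>The influences of \<open>f\<close> fix the odd-subset sums of its Fourier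
    coefficients, and left inversion then identifies those coefficients with
    \<open>c\<close>.\<close>
  have eq: "f = ?g" if "?P f" for f
  proof -
    define d where "d = fourier_coeff n f"
    have f: "f = odd_expansion n d"
      using that self_dual_eq_odd_expansion by (auto simp: d_def)
    have half: "i T / 2 = (\<Sum>S | S \<subseteq> T \<and> odd (card S). d S)"
      if "T \<subseteq> ground n" "odd (card T)" for T
      using that \<open>?P f\<close> banzhaf_influence_odd_expansion[of T n d] f by auto
    have "c S = d S" if S: "S \<subseteq> ground n" "odd (card S)" for S
    proof -
      have "c S = (\<Sum>T | T \<subseteq> S \<and> odd (card T). euler_number (card S - card T) *
          (\<Sum>U | U \<subseteq> T \<and> odd (card U). d U))"
        unfolding c_def
      proof (intro sum.cong refl)
        fix T assume "T \<in> {T. T \<subseteq> S \<and> odd (card T)}"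
        then have "i T / 2 = (\<Sum>U | U \<subseteq> T \<and> odd (card U). d U)"
          using S by (intro half) auto
        then show "euler_number (card S - card T) * (i T / 2)
            = euler_number (card S - card T) * (\<Sum>U | U \<subseteq> T \<and> odd (card U). d U)"
          by (rule arg_cong)
      qed
      then show ?thesis
        using S by (simp add: euler_inversion_left finite_subset_ground)
    qed
    \<comment> \<open>Agreement at odd sets suffices, since \<open>odd_expansion\<close> reads its
      coefficients only there.\<close>
    then have "odd_expansion n d = odd_expansion n c"
      unfolding odd_expansion_def by (intro restrict_ext sum.cong refl) auto
    with f show ?thesis unfolding g by (rule trans)
  qed
  show ?thesis
  proof (rule conjI)
    show "\<exists>!f. ?P f" using P eq by (rule ex1I)
    show "\<forall>f. ?P f \<longrightarrow> f = ?g" by (rule allI, rule impI, rule eq)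
  qed
qed

end
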